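(* Let $P$ and $Q$ be probability distributions on finite sets with $H(P)>0$ and $H(Q)>0$, let $\nu\in(0,1)$, and let $\mathcal R^1_{P,Q}=\mathcal R^{1,\mathcal D}_{P,Q}(\nu)=\mathcal R^{1,\mathcal M}_{P,Q}(\nu)$ be the first-order rate region (the two regions coincide and do not depend on $\nu$). The set of semi-admissible rate pairs is $$\left\{\left(s_1,\frac{s_1}{H(Q)}\right)\ \Big|\ 0<s_1\le H(P)\right\},$$ and $\left(H(P),\frac{H(P)}{H(Q)}\right)$ is the unique admissible rate pair.
   Context: All logarithms are to base $2$. $\mathcal P(\mathcal X)$ is the set of probability distributions on a finite set $\mathcal X$; $P^n$ is the $n$-fold i.i.d. product. $H(P)=-\sum_x P(x)\log P(x)$. For a map $f:\mathcal X\to\mathcal Y$, $W_f(P)(y)=\sum_{x\in f^{-1}(y)}P(x)$. Fidelity: $F(Q,Q')=\sum_y\sqrt{Q(y)}\sqrt{Q'(y)}$. $P^{\downarrow}_i$ is the $i$-th largest value of $P$ (and $0$ beyond the size of the set). $P\prec Q$ means $\sum_{i=1}^l P^{\downarrow}_i\le\sum_{i=1}^l Q^{\downarrow}_i$ for all $l$ (the finite sets may differ). A storage of $N$ bits is $K_N=\{0,1\}^N$; for real $N\ge0$ it is a set of $\lfloor 2^N\rfloor$ elements. For $P\in\mathcal P(\mathcal X)$, $Q\in\mathcal P(\mathcal Y)$, $F^{\mathcal D}(P\to Q|N)=\sup_{f:\mathcal X\to K_N,\ f':K_N\to\mathcal Y}F(W_{f'}\circ W_f(P),Q)$ and $F^{\mathcal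 M}(P\to Q|N)=\sup\{F(P'',Q)\mid P''\in\mathcal P(\mathcal Y),\ \exists P'\in\mathcal P(K_N):\ P\prec P'\prec P''\}$. For $i\in\{\mathcal D,\mathcal M\}$, $\mathcal R^{1,i}_{P,Q}(\nu)$ is the set of pairs $(s_1,t_1)$ with $s_1,t_1>0$ for which there exist $S_n=s_1n+o(n)$ (nonnegative reals) and $T_n=t_1n+o(n)$ (nonnegative integers) with $\liminf_{n\to\infty}F^i(P^n\to Q^{T_n}|S_n)\ge\nu$. Pairs in the region are called achievable. For pairs of positive rates: $(s_1,t_1)$ dominates $(s_1',t_1')$ iff $s_1\le s_1'$ and $t_1\ge t_1'$; $(s_1,t_1)$ simulates $(s_1',t_1')$ iff $s_1'/s_1=t_1'/t_1\le1$. A pair in $\mathcal R^1_{P,Q}$ is semi-admissible if no other achievable pair dominates it, and admissible if no other achievable pair dominates or simulates it. *)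

theory Defs
  imports "HOL-Probability.Probability" "HOL-Library.Landau_Symbols"
begin

text \<open>
  A finite set is a carrier \<open>X :: 'a set\<close> with \<^term>\<open>finite X\<close>; a probability distribution on it
  is a \<^typ>\<open>'a pmf\<close> whose support lies in \<open>X\<close>. For \<open>f\<close> mapping \<open>X\<close> to \<open>Y\<close> the
  distribution \<open>W\<^sub>f(P)\<close> is the push-forward \<^term>\<open>map_pmf f P\<close>, and \<open>P\<^sup>n\<close> is
  \<^term>\<open>replicate_pmf n P\<close>, which lives on the lists of length \<open>n\<close> over \<open>X\<close>.
\<close>

definition distributions :: "'a set \<Rightarrow> 'a pmf set" where
  "distributions X = {P. set_pmf P \<subseteq> X}"

definition words :: "nat \<Rightarrow> 'a set \<Rightarrow> 'a list set" where
  "words n X = {xs. set xs \<subseteq> X \<and> length xs = n}"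

text \<open>The convention \<open>0 log 0 = 0\<close> is automatic, because the factor \<^term>\<open>pmf P x\<close> vanishes.\<close>

definition shannon_entropy :: "'a set \<Rightarrow> 'a pmf \<Rightarrow> real" where
  "shannon_entropy X P = - (\<Sum>x\<in>X. pmf P x * log 2 (pmf P x))"

definition fidelity :: "'b set \<Rightarrow> 'b pmf \<Rightarrow> 'b pmf \<Rightarrow> real" where
  "fidelity Y Q Q' = (\<Sum>y\<in>Y. sqrt (pmf Q y) * sqrt (pmf Q' y))"

text \<open>The \<open>i\<close>-th largest value counted with multiplicity; indices start at 1.\<close>

definition decreasing_value :: "'a set \<Rightarrow> 'a pmf \<Rightarrow> nat \<Rightarrow> real" where
  "decreasing_value X P i =
     (if 1 \<le> i \<and> i \<le> card X
      then rev (sorted_list_of_multiset (image_mset (pmf P) (mset_set X))) ! (i - 1)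
      else 0)"

definition majorized :: "'a set \<Rightarrow> 'a pmf \<Rightarrow> 'b set \<Rightarrow> 'b pmf \<Rightarrow> bool" where
  "majorized X P Y Q \<longleftrightarrow>
     (\<forall>l::nat. (\<Sum>i=1..l. decreasing_value X P i) \<le> (\<Sum>i=1..l. decreasing_value Y Q i))"

definition storage :: "real \<Rightarrow> nat set" where
  "storage N = {..<nat \<lfloor>2 powr N\<rfloor>}"

text \<open>
  Both suprema are over nonempty sets of reals bounded by 1 whenever \<open>N \<ge> 0\<close>, \<open>Y\<close> is finite and
  \<open>Q \<in> distributions Y\<close>, so the conditionally complete supremum on \<^typ>\<open>real\<close> is the genuine one.
\<close>

definition fidelity_D :: "'a set \<Rightarrow> 'a pmf \<Rightarrow> 'b set \<Rightarrow> 'b pmf \<Rightarrow> real \<Rightarrow> real" where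
  "fidelity_D X P Y Q N =
     Sup {fidelity Y (map_pmf f' (map_pmf f P)) Q | f f'.
            f \<in> X \<rightarrow> storage N \<and> f' \<in> storage N \<rightarrow> Y}"

definition fidelity_M :: "'a set \<Rightarrow> 'a pmf \<Rightarrow> 'b set \<Rightarrow> 'b pmf \<Rightarrow> real \<Rightarrow> real" where
  "fidelity_M X P Y Q N =
     Sup {fidelity Y P'' Q | P''.
            P'' \<in> distributions Y \<and>
            (\<exists>P' \<in> distributions (storage N).
               majorized X P (storage N) P' \<and> majorized (storage N) P' Y P'')}"

text \<open>
  The argument \<open>F\<close> is \<^const>\<open>fidelity_D\<close> or \<^const>\<open>fidelity_M\<close>. The limit inferior is taken in
  \<^typ>\<open>ereal\<close>, where it always exists.
\<close>

definition rate_region ::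
  "('a list set \<Rightarrow> 'a list pmf \<Rightarrow> 'b list set \<Rightarrow> 'b list pmf \<Rightarrow> real \<Rightarrow> real) \<Rightarrow>
   'a set \<Rightarrow> 'a pmf \<Rightarrow> 'b set \<Rightarrow> 'b pmf \<Rightarrow> real \<Rightarrow> (real \<times> real) set" where
  "rate_region F X P Y Q \<nu> =
     {(s, t). s > 0 \<and> t > 0 \<and>
        (\<exists>(S :: nat \<Rightarrow> real) (T :: nat \<Rightarrow> nat).
           (\<forall>n. S n \<ge> 0) \<and>
           (\<lambda>n. S n - s * real n) \<in> o(\<lambda>n. real n) \<and>
           (\<lambda>n. real (T n) - t * real n) \<in> o(\<lambda>n. real n) \<and>
           liminf (\<lambda>n. ereal (F (words n X) (replicate_pmf n P)
                                (words (T n) Y) (replicate_pmf (T n) Q) (S n))) \<ge> ereal \<nu>)}"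

abbreviation "rate_region_D \<equiv> rate_region fidelity_D"
abbreviation "rate_region_M \<equiv> rate_region fidelity_M"

definition dominates :: "real \<times> real \<Rightarrow> real \<times> real \<Rightarrow> bool" where
  "dominates p p' \<longleftrightarrow> fst p \<le> fst p' \<and> snd p \<ge> snd p'"

definition simulates :: "real \<times> real \<Rightarrow> real \<times> real \<Rightarrow> bool" where
  "simulates p p' \<longleftrightarrow> fst p' / fst p = snd p' / snd p \<and> fst p' / fst p \<le> 1"

definition semi_admissible :: "(real \<times> real) set \<Rightarrow> real \<times> real \<Rightarrow> bool" where
  "semi_admissible R p \<longleftrightarrow> p \<in> R \<and> \<not> (\<exists>q\<in>R. q \<noteq> p \<and> dominates q p)"

definition admissible :: "(real \<times> real) set \<Rightarrow> real \<times> real \<Rightarrow> bool" where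
  "admissible R p \<longleftrightarrow> p \<in> R \<and> \<not> (\<exists>q\<in>R. q \<noteq> p \<and> (dominates q p \<or> simulates q p))"

end

theory Submission
  imports Defs "HOL-Real_Asymp.Real_Asymp"
begin

text \<open>
  Both regions equal \<open>{(s, t). 0 < s \<and> 0 < t \<and> t H(Q) \<le> min s (H(P))}\<close>, from which the (semi-)admissible
  pairs are read off. A pair of storage maps yields a feasible majorization chain, so the deterministic
  region lies in the majorization one. By Chebyshev's inequality, up to small probability \<open>P\<^sup>n\<close> and
  \<open>Q\<^sup>T\<close> are almost uniform with exponents \<open>n H(P)\<close> and \<open>T H(Q)\<close>. For achievability, typical source
  words are packed greedily into the typical target words. For the converse, majorization
  forces the output to concentrate on at most \<open>2\<^sup>S\<close>, respectively about \<open>2\<close> to the \<open>n H(P)\<close>, target words;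
  if \<open>t H(Q)\<close> exceeds \<open>s\<close> or \<open>H(P)\<close>, such a set has vanishing \<open>Q\<^sup>T\<close>-probability, and by
  the Cauchy-Schwarz inequality the fidelity tends to 0.
\<close>

subsection \<open>Majorization and sums of largest values\<close>

text \<open>Replaces the sorted list of values by an enumeration of the carrier itself, so that
  partial sums of \<open>decreasing_value\<close> become probabilities of prefixes. For
  \<open>l\<close> beyond the length, \<open>take l ys\<close> is the whole list, in agreement with
  the value 0 beyond \<open>card X\<close>.\<close>

lemma enumerate_decreasing:
  fixes P :: "'a pmf"
  assumes "finite X"
  obtains ys where "distinct ys" "set ys = X"
    "sorted_wrt (\<lambda>x y. pmf P x \<ge> pmf P y) ys"
    "\<And>l. (\<Sum>i=1..l. decreasing_value X P i) = measure_pmf.prob P (set (take l ys))"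
proof -
  obtain zs where zs: "set zs = X" "distinct zs"
    using finite_distinct_list[OF assms] by blast
  define ys where "ys = rev (sort_key (pmf P) zs)"
  have d: "distinct ys" and s: "set ys = X"
    using zs by (auto simp: ys_def)
  have len: "length ys = card X"
    using d s distinct_card by fastforce
  have "sorted (map (pmf P) (sort_key (pmf P) zs))"
    by simp
  hence so: "sorted_wrt (\<lambda>x y. pmf P x \<ge> pmf P y) ys"
    by (simp add: ys_def sorted_wrt_rev sorted_wrt_map)
  have "image_mset (pmf P) (mset_set X) = mset (map (pmf P) zs)"
    using zs by (simp add: mset_set_set[symmetric])
  hence "sorted_list_of_multiset (image_mset (pmf P) (mset_set X)) = sort (map (pmf P) zs)"
    by (simp del: mset_map)
  also have "\<dots> = map (pmf P) (sort_key (pmf P) zs)"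
    by (rule properties_for_sort) auto
  finally have "rev (sorted_list_of_multiset (image_mset (pmf P) (mset_set X))) = map (pmf P) ys"
    by (simp add: ys_def rev_map)
  \<comment> \<open>\<open>decreasing_value\<close> counts from 1 and lists from 0, hence the
    \<open>Suc\<close>.\<close>
  hence dv: "decreasing_value X P (Suc i) = (if i < length ys then pmf P (ys ! i) else 0)" for i
    by (simp add: decreasing_value_def len Suc_le_eq)
  have "(\<Sum>i=1..l. decreasing_value X P i) = measure_pmf.prob P (set (take l ys))" for l
  proof (induction l)
    case (Suc l)
    show ?case
    proof (cases "l < length ys")
      case True
      have "ys ! l \<notin> set (take l ys)"
        using d True by (auto simp: in_set_conv_nth nth_eq_iff_index_eq)
      thus ?thesis using Suc True dv[of l]
        by (simp add: take_Suc_conv_app_nth measure_measure_pmf_finite)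
    next
      case False
      thus ?thesis using Suc dv[of l] by simp
    qed
  qed simp
  with d s so show thesis by (rule that)
qed

text \<open>With the next lemma this gives the variational form: the sum of the \<open>l\<close>
  largest values is the maximal probability of a set with at most \<open>l\<close> elements. The
  bound on \<open>card B\<close> may be strict, since \<open>l\<close> may exceed
  \<open>card X\<close>.\<close>

lemma sum_decreasing_value_attained:
  assumes "finite X"
  shows "\<exists>B\<subseteq>X. card B \<le> l \<and> (\<Sum>i=1..l. decreasing_value X P i) = measure_pmf.prob P B"
proof -
  obtain ys where ys: "distinct ys" "set ys = X"
    "\<And>l. (\<Sum>i=1..l. decreasing_value X P i) = measure_pmf.prob P (set (take l ys))"
    using enumerate_decreasing[OF assms] by metis
  have "card (set (take l ys)) \<le> l"
    by (rule order_trans[OF card_length]) simp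
  thus ?thesis using ys set_take_subset by metis
qed

text \<open>An exchange argument: each element of the prefix \<open>T\<close> missing from
  \<open>A\<close> weighs at least as much as each element of \<open>A\<close> outside
  \<open>T\<close>, and there are at least as many of the former as of the latter.\<close>

lemma prob_le_sum_decreasing_value:
  assumes "finite X" "A \<subseteq> X" "card A \<le> l"
  shows "measure_pmf.prob P A \<le> (\<Sum>i=1..l. decreasing_value X P i)"
proof -
  obtain ys where ys: "distinct ys" "set ys = X"
    "sorted_wrt (\<lambda>x y. pmf P x \<ge> pmf P y) ys"
    "\<And>l. (\<Sum>i=1..l. decreasing_value X P i) = measure_pmf.prob P (set (take l ys))"
    using enumerate_decreasing[OF assms(1)] by metis
  define T where "T = set (take l ys)"
  have fin: "finite A" "finite T"
    using assms finite_subset by (auto simp: T_def)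
  have ge: "pmf P x \<le> pmf P y" if "x \<in> A - T" "y \<in> T - A" for x y
  proof -
    have "x \<in> set (drop l ys)"
      using that assms(2) ys(2) set_append[of "take l ys" "drop l ys"] unfolding T_def by auto
    moreover have "sorted_wrt (\<lambda>x y. pmf P x \<ge> pmf P y) (take l ys @ drop l ys)"
      using ys(3) by simp
    ultimately show ?thesis using that unfolding sorted_wrt_append T_def by auto
  qed
  have cT: "card T = min l (card X)"
    using ys(1,2) distinct_card[of "take l ys"] distinct_card[of ys] by (simp add: T_def min.commute)
  have "card A \<le> card T"
    using assms card_mono[of X A] by (simp add: cT)
  hence c: "card (A - T) \<le> card (T - A)"
    using fin by (simp add: card_le_sym_Diff)
  have "sum (pmf P) (A - T) \<le> sum (pmf P) (T - A)"
  proof (cases "T - A = {}")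
    case True
    hence "A - T = {}" using c fin by (metis card.empty card_0_eq finite_Diff le_zero_eq)
    with True show ?thesis by (simp only: sum.empty order_refl)
  next
    case False
    \<comment> \<open>The lightest weight in \<open>T - A\<close> separates the two differences and
      reduces their comparison to cardinalities.\<close>
    define v where "v = Min (pmf P ` (T - A))"
    have v1: "v \<le> pmf P y" if "y \<in> T - A" for y
      using that fin by (auto simp: v_def intro!: Min_le)
    have "v \<in> pmf P ` (T - A)"
      unfolding v_def using fin False by (intro Min_in) auto
    hence v2: "pmf P x \<le> v" if "x \<in> A - T" for x
      using ge that by auto
    have "0 \<le> v"
      using \<open>v \<in> pmf P ` (T - A)\<close> by auto
    have "sum (pmf P) (A - T) \<le> real (card (A - T)) * v"
      using v2 by (intro sum_bounded_above) auto
    also have "\<dots> \<le> real (card (T - A)) * v"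
      using c \<open>0 \<le> v\<close> by (intro mult_right_mono) auto
    also have "\<dots> \<le> sum (pmf P) (T - A)"
      using v1 by (intro sum_bounded_below) auto
    finally show ?thesis .
  qed
  hence "sum (pmf P) (A - T) + sum (pmf P) (A \<inter> T) \<le> sum (pmf P) (T - A) + sum (pmf P) (T \<inter> A)"
    by (simp add: Int_commute)
  hence "sum (pmf P) A \<le> sum (pmf P) T"
    using sum.Int_Diff[of A "pmf P" T] sum.Int_Diff[of T "pmf P" A] fin by simp
  thus ?thesis
    using fin unfolding ys(4) T_def[symmetric] by (simp add: measure_measure_pmf_finite)
qed

text \<open>The form in which the converse uses majorization: mass on few elements is carried to
  mass on no more elements.\<close>

lemma majorizedD:
  assumes "majorized X P Y Q" "finite X" "finite Y" "A \<subseteq> X"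
  shows "\<exists>B\<subseteq>Y. card B \<le> card A \<and> measure_pmf.prob P A \<le> measure_pmf.prob Q B"
proof -
  have "measure_pmf.prob P A \<le> (\<Sum>i=1..card A. decreasing_value X P i)"
    using assms by (intro prob_le_sum_decreasing_value) auto
  also have "\<dots> \<le> (\<Sum>i=1..card A. decreasing_value Y Q i)"
    using assms(1) by (simp add: majorized_def)
  finally show ?thesis
    using sum_decreasing_value_attained[OF assms(3), of "card A" Q] by auto
qed

lemma majorized_map_pmf:
  assumes "finite X" "finite Y" "f \<in> X \<rightarrow> Y"
  shows "majorized X P Y (map_pmf f P)"
  unfolding majorized_def
proof
  fix l
  obtain A where A: "A \<subseteq> X" "card A \<le> l"
    "(\<Sum>i=1..l. decreasing_value X P i) = measure_pmf.prob P A"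
    using sum_decreasing_value_attained[OF assms(1)] by blast
  note A(3)
  also have "measure_pmf.prob P A \<le> measure_pmf.prob (map_pmf f P) (f ` A)"
    by (simp, intro measure_pmf.finite_measure_mono) auto
  also have "\<dots> \<le> (\<Sum>i=1..l. decreasing_value Y (map_pmf f P) i)"
  proof (rule prob_le_sum_decreasing_value)
    show "card (f ` A) \<le> l"
      using A card_image_le[of A f] finite_subset[OF A(1) assms(1)] by linarith
  qed (use A assms in auto)
  finally show "(\<Sum>i=1..l. decreasing_value X P i)
      \<le> (\<Sum>i=1..l. decreasing_value Y (map_pmf f P) i)" .
qed

subsection \<open>One-shot fidelity bounds\<close>

lemma sum_pmf_le_1: "finite A \<Longrightarrow> sum (pmf P) A \<le> 1"
  by (metis measure_measure_pmf_finite measure_pmf.prob_le_1)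

text \<open>Cauchy-Schwarz for the vectors of square roots, whose squared norms over
  \<open>B\<close> are the probabilities of \<open>B\<close>.\<close>

lemma sum_sqrt_pmf_le:
  assumes "finite B"
  shows "(\<Sum>y\<in>B. sqrt (pmf P y) * sqrt (pmf Q y))
    \<le> sqrt (measure_pmf.prob P B) * sqrt (measure_pmf.prob Q B)"
proof -
  have "(\<Sum>y\<in>B. \<bar>sqrt (pmf P y)\<bar> * \<bar>sqrt (pmf Q y)\<bar>)
      \<le> L2_set (\<lambda>y. sqrt (pmf P y)) B * L2_set (\<lambda>y. sqrt (pmf Q y)) B"
    by (rule L2_set_mult_ineq)
  thus ?thesis
    using assms by (simp add: L2_set_def measure_measure_pmf_finite)
qed

lemma fidelity_le_1:
  assumes "finite Y"
  shows "fidelity Y P Q \<le> 1"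
proof -
  have "fidelity Y P Q \<le> sqrt (measure_pmf.prob P Y) * sqrt (measure_pmf.prob Q Y)"
    unfolding fidelity_def by (rule sum_sqrt_pmf_le[OF assms])
  also have "\<dots> \<le> 1 * 1"
    by (intro mult_mono) auto
  finally show ?thesis by simp
qed

text \<open>Cauchy-Schwarz is applied separately on \<open>B\<close>, where \<open>Q\<close> may be
  small, and on \<open>Y - B\<close>, where \<open>P\<close> is small.\<close>

lemma fidelity_le_concentrated:
  assumes "finite Y" "B \<subseteq> Y" "measure_pmf.prob P B \<ge> 1 - \<epsilon>"
  shows "fidelity Y P Q \<le> sqrt (measure_pmf.prob Q B) + sqrt \<epsilon>"
proof -
  have fB: "finite B" using assms finite_subset by blast
  have "fidelity Y P Q = (\<Sum>y\<in>B. sqrt (pmf P y) * sqrt (pmf Q y))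
      + (\<Sum>y\<in>Y-B. sqrt (pmf P y) * sqrt (pmf Q y))"
    unfolding fidelity_def using assms by (simp add: sum.subset_diff add.commute)
  also have "\<dots> \<le> sqrt (measure_pmf.prob P B) * sqrt (measure_pmf.prob Q B)
      + sqrt (measure_pmf.prob P (Y-B)) * sqrt (measure_pmf.prob Q (Y-B))"
    using assms(1) fB by (intro add_mono sum_sqrt_pmf_le) auto
  also have "\<dots> \<le> 1 * sqrt (measure_pmf.prob Q B) + sqrt \<epsilon> * 1"
  proof (intro add_mono mult_mono)
    have "measure_pmf.prob P (Y-B) \<le> measure_pmf.prob P (space (measure_pmf P) - B)"
      by (intro measure_pmf.finite_measure_mono) auto
    also have "\<dots> = 1 - measure_pmf.prob P B"
      by (intro measure_pmf.prob_compl) auto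
    finally show le: "sqrt (measure_pmf.prob P (Y-B)) \<le> sqrt \<epsilon>"
      using assms(3) by simp
    \<comment> \<open>The sign of \<open>\<epsilon>\<close> is inherited from the probability that
      it bounds.\<close>
    show "0 \<le> sqrt \<epsilon>"
      by (rule order_trans[OF _ le]) simp
  qed auto
  finally show ?thesis by simp
qed

text \<open>Elements heavier than \<open>m\<close> are charged to the tail event; each of the others
  contributes at most \<open>m\<close>.\<close>

lemma prob_le_card_mult:
  assumes "finite B" "0 \<le> m"
  shows "measure_pmf.prob Q B \<le> measure_pmf.prob Q {y. pmf Q y > m} + real (card B) * m"
proof -
  let ?D = "{y. pmf Q y > m}"
  have "measure_pmf.prob Q B \<le> measure_pmf.prob Q (?D \<union> (B - ?D))"
    by (intro measure_pmf.finite_measure_mono) auto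
  also have "\<dots> \<le> measure_pmf.prob Q ?D + measure_pmf.prob Q (B - ?D)"
    by (intro measure_Un_le) auto
  also have "measure_pmf.prob Q (B - ?D) = (\<Sum>y\<in>B - ?D. pmf Q y)"
    using assms by (simp add: measure_measure_pmf_finite)
  also have "\<dots> \<le> real (card (B - ?D)) * m"
    by (intro sum_bounded_above) auto
  also have "\<dots> \<le> real (card B) * m"
    using assms by (intro mult_right_mono) (auto intro: card_mono)
  finally show ?thesis by simp
qed

section \<open>Storage and the suprema defining the two fidelities\<close>

lemma finite_storage [simp]: "finite (storage N)"
  by (simp add: storage_def)

lemma card_storage_le: "real (card (storage N)) \<le> 2 powr N"
  by (simp add: storage_def)

lemma zero_in_storage: "N \<ge> 0 \<Longrightarrow> 0 \<in> storage N"
  using ge_one_powr_ge_zero[of 2 N] by (auto simp: storage_def)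

lemma distributions_nonempty: "Q \<in> distributions Y \<Longrightarrow> Y \<noteq> {}"
  using set_pmf_not_empty[of Q] by (auto simp: distributions_def)

text \<open>Constant maps suffice. The lemma makes the sets under both suprema nonempty, as
  \<open>cSup_least\<close> requires.\<close>

lemma ex_storage_maps:
  assumes "Q \<in> distributions Y" "N \<ge> 0"
  shows "\<exists>f f'. f \<in> X \<rightarrow> storage N \<and> f' \<in> storage N \<rightarrow> Y"
proof -
  obtain y where "y \<in> Y" using distributions_nonempty[OF assms(1)] by auto
  hence "(\<lambda>_. 0) \<in> X \<rightarrow> storage N" "(\<lambda>_. y) \<in> storage N \<rightarrow> Y"
    using zero_in_storage[OF assms(2)] by auto
  thus ?thesis by blast
qed

lemma fidelity_D_leI:
  assumes "Q \<in> distributions Y" "N \<ge> 0"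
    and "\<And>f f'. f \<in> X \<rightarrow> storage N \<Longrightarrow> f' \<in> storage N \<rightarrow> Y \<Longrightarrow>
      fidelity Y (map_pmf f' (map_pmf f P)) Q \<le> c"
  shows "fidelity_D X P Y Q N \<le> c"
  unfolding fidelity_D_def
proof (rule cSup_least)
  obtain f f' where "f \<in> X \<rightarrow> storage N" "f' \<in> storage N \<rightarrow> Y"
    using ex_storage_maps[OF assms(1,2), where X=X] by (elim exE conjE) (rule that; assumption)
  hence "fidelity Y (map_pmf f' (map_pmf f P)) Q \<in> {fidelity Y (map_pmf f' (map_pmf f P)) Q |f f'.
      f \<in> X \<rightarrow> storage N \<and> f' \<in> storage N \<rightarrow> Y}"
    by (intro CollectI exI[of _ f] exI[of _ f'] conjI refl)
  thus "{fidelity Y (map_pmf f' (map_pmf f P)) Q |f f'.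
      f \<in> X \<rightarrow> storage N \<and> f' \<in> storage N \<rightarrow> Y} \<noteq> {}"
    by (metis empty_iff)
next
  fix r assume "r \<in> {fidelity Y (map_pmf f' (map_pmf f P)) Q |f f'.
      f \<in> X \<rightarrow> storage N \<and> f' \<in> storage N \<rightarrow> Y}"
  then obtain f f' where "r = fidelity Y (map_pmf f' (map_pmf f P)) Q"
    "f \<in> X \<rightarrow> storage N" "f' \<in> storage N \<rightarrow> Y"
    by (elim CollectE exE conjE) (rule that; assumption)
  thus "r \<le> c" using assms(3) by simp
qed

lemma fidelity_D_upper:
  assumes "finite Y" "f \<in> X \<rightarrow> storage N" "f' \<in> storage N \<rightarrow> Y"
  shows "fidelity Y (map_pmf f' (map_pmf f P)) Q \<le> fidelity_D X P Y Q N"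
  unfolding fidelity_D_def
proof (rule cSup_upper)
  show "fidelity Y (map_pmf f' (map_pmf f P)) Q \<in> {fidelity Y (map_pmf f' (map_pmf f P)) Q |f f'.
      f \<in> X \<rightarrow> storage N \<and> f' \<in> storage N \<rightarrow> Y}"
    by (intro CollectI exI[of _ f] exI[of _ f'] conjI refl assms)
  show "bdd_above {fidelity Y (map_pmf f' (map_pmf f P)) Q |f f'.
      f \<in> X \<rightarrow> storage N \<and> f' \<in> storage N \<rightarrow> Y}"
  proof (rule bdd_aboveI)
    fix r assume "r \<in> {fidelity Y (map_pmf f' (map_pmf f P)) Q |f f'.
      f \<in> X \<rightarrow> storage N \<and> f' \<in> storage N \<rightarrow> Y}"
    thus "r \<le> 1" using fidelity_le_1[OF assms(1)] by auto
  qed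
qed

lemma fidelity_M_upper:
  assumes "finite Y" "P'' \<in> distributions Y" "P' \<in> distributions (storage N)"
    and "majorized X P (storage N) P'" "majorized (storage N) P' Y P''"
  shows "fidelity Y P'' Q \<le> fidelity_M X P Y Q N"
  unfolding fidelity_M_def
proof (rule cSup_upper)
  show "fidelity Y P'' Q \<in> {fidelity Y P'' Q |P''. P'' \<in> distributions Y \<and>
      (\<exists>P'\<in>distributions (storage N). majorized X P (storage N) P' \<and> majorized (storage N) P' Y P'')}"
    by (intro CollectI exI[of _ P''] conjI refl bexI[of _ P'] assms)
  show "bdd_above {fidelity Y P'' Q |P''. P'' \<in> distributions Y \<and>
      (\<exists>P'\<in>distributions (storage N). majorized X P (storage N) P' \<and> majorized (storage N) P' Y P'')}"
  proof (rule bdd_aboveI)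
    fix r assume "r \<in> {fidelity Y P'' Q |P''. P'' \<in> distributions Y \<and>
      (\<exists>P'\<in>distributions (storage N). majorized X P (storage N) P' \<and> majorized (storage N) P' Y P'')}"
    then obtain P'' where "r = fidelity Y P'' Q" by (elim CollectE exE conjE) (rule that; assumption)
    thus "r \<le> 1" using fidelity_le_1[OF assms(1)] by simp
  qed
qed

text \<open>The distributions \<open>P\<close>, \<open>map_pmf f P\<close> and
  \<open>map_pmf f' (map_pmf f P)\<close> form a feasible majorization chain, because a push-forward
  majorizes its source.\<close>

lemma fidelity_D_le_M:
  assumes "finite X" "finite Y" "P \<in> distributions X" "Q \<in> distributions Y" "N \<ge> 0"
  shows "fidelity_D X P Y Q N \<le> fidelity_M X P Y Q N"
proof (rule fidelity_D_leI[OF assms(4,5)])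
  fix f f' assume f: "f \<in> X \<rightarrow> storage N" "f' \<in> storage N \<rightarrow> Y"
  show "fidelity Y (map_pmf f' (map_pmf f P)) Q \<le> fidelity_M X P Y Q N"
  proof (rule fidelity_M_upper[OF assms(2)])
    show "map_pmf f P \<in> distributions (storage N)" "map_pmf f' (map_pmf f P) \<in> distributions Y"
      using assms f by (auto simp: distributions_def)
  qed (intro majorized_map_pmf assms f finite_storage)+
qed

lemma fidelity_M_leI:
  assumes "finite X" "finite Y" "P \<in> distributions X" "Q \<in> distributions Y" "N \<ge> 0"
    and "\<And>P' P''. P' \<in> distributions (storage N) \<Longrightarrow> P'' \<in> distributions Y \<Longrightarrow>
      majorized X P (storage N) P' \<Longrightarrow> majorized (storage N) P' Y P'' \<Longrightarrow> fidelity Y P'' Q \<le> c"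
  shows "fidelity_M X P Y Q N \<le> c"
  unfolding fidelity_M_def
proof (rule cSup_least)
  obtain f f' where f: "f \<in> X \<rightarrow> storage N" "f' \<in> storage N \<rightarrow> Y"
    using ex_storage_maps[OF assms(4,5), where X=X] by (elim exE conjE) (rule that; assumption)
  have d: "map_pmf f P \<in> distributions (storage N)" "map_pmf f' (map_pmf f P) \<in> distributions Y"
    using assms f by (auto simp: distributions_def)
  have "fidelity Y (map_pmf f' (map_pmf f P)) Q \<in> {fidelity Y P'' Q |P''. P'' \<in> distributions Y \<and>
      (\<exists>P'\<in>distributions (storage N). majorized X P (storage N) P' \<and> majorized (storage N) P' Y P'')}"
    by (intro CollectI exI[of _ "map_pmf f' (map_pmf f P)"] conjI refl bexI[of _ "map_pmf f P"]
        majorized_map_pmf assms f d finite_storage)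
  thus "{fidelity Y P'' Q |P''. P'' \<in> distributions Y \<and>
      (\<exists>P'\<in>distributions (storage N). majorized X P (storage N) P' \<and> majorized (storage N) P' Y P'')} \<noteq> {}"
    by (metis empty_iff)
next
  fix r assume "r \<in> {fidelity Y P'' Q |P''. P'' \<in> distributions Y \<and>
      (\<exists>P'\<in>distributions (storage N). majorized X P (storage N) P' \<and> majorized (storage N) P' Y P'')}"
  then obtain P'' P' where "r = fidelity Y P'' Q" "P'' \<in> distributions Y"
    "P' \<in> distributions (storage N)" "majorized X P (storage N) P'" "majorized (storage N) P' Y P''"
    by (elim CollectE exE conjE bexE) (rule that; assumption)
  thus "r \<le> c" using assms(6) by simp
qed

section \<open>Upper bounds on the majorization fidelity\<close>

text \<open>The common end of both converse bounds: \<open>P''\<close> lives on \<open>B\<close> up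
  to \<open>\<epsilon>\<close>, while \<open>Q\<close> gives a set of at most \<open>k\<close>
  elements no more than \<open>\<delta> + k * m\<close>.\<close>

lemma fidelity_le_small_support:
  assumes "finite Y" "B \<subseteq> Y" "measure_pmf.prob P'' B \<ge> 1 - \<epsilon>" "real (card B) \<le> k"
    and "0 \<le> m" "measure_pmf.prob Q {y. pmf Q y > m} \<le> \<delta>"
  shows "fidelity Y P'' Q \<le> sqrt (\<delta> + k * m) + sqrt \<epsilon>"
proof -
  have "measure_pmf.prob Q B \<le> measure_pmf.prob Q {y. pmf Q y > m} + real (card B) * m"
    using assms finite_subset by (intro prob_le_card_mult) auto
  also have "\<dots> \<le> \<delta> + k * m"
    using assms by (intro add_mono mult_right_mono)
  finally have "sqrt (measure_pmf.prob Q B) \<le> sqrt (\<delta> + k * m)" by simp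
  thus ?thesis using fidelity_le_concentrated[OF assms(1-3), of Q] by linarith
qed

text \<open>The whole storage has probability 1 under \<open>P'\<close>, so \<open>P''\<close> is
  carried by at most \<open>card (storage N)\<close> elements and the error
  \<open>\<epsilon>\<close> is 0.\<close>

lemma fidelity_M_le_storage:
  assumes "finite X" "finite Y" "P \<in> distributions X" "Q \<in> distributions Y" "N \<ge> 0"
    and "0 \<le> m" "measure_pmf.prob Q {y. pmf Q y > m} \<le> \<delta>"
  shows "fidelity_M X P Y Q N \<le> sqrt (\<delta> + 2 powr N * m)"
proof (rule fidelity_M_leI[OF assms(1-5)])
  fix P' P'' assume *: "P' \<in> distributions (storage N)" "majorized (storage N) P' Y P''"
  obtain B where B: "B \<subseteq> Y" "card B \<le> card (storage N)"
    "measure_pmf.prob P' (storage N) \<le> measure_pmf.prob P'' B"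
    using majorizedD[OF *(2) _ assms(2), of "storage N"] by auto
  have "measure_pmf.prob P' (storage N) = 1"
    using *(1) by (auto simp: distributions_def measure_pmf.prob_eq_1 AE_measure_pmf_iff)
  with B have "fidelity Y P'' Q \<le> sqrt (\<delta> + 2 powr N * m) + sqrt 0"
    using card_storage_le[of N] assms by (intro fidelity_le_small_support[of Y B]) auto
  thus "fidelity Y P'' Q \<le> sqrt (\<delta> + 2 powr N * m)" by simp
qed

text \<open>By transitivity of majorization the intermediate \<open>P'\<close> drops out, and the
  likely source set \<open>A\<close> is carried to a target set that is no larger.\<close>

lemma fidelity_M_le_source:
  assumes "finite X" "finite Y" "P \<in> distributions X" "Q \<in> distributions Y" "N \<ge> 0"
    and "A \<subseteq> X" "real (card A) \<le> k" "measure_pmf.prob P A \<ge> 1 - \<epsilon>"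
    and "0 \<le> m" "measure_pmf.prob Q {y. pmf Q y > m} \<le> \<delta>"
  shows "fidelity_M X P Y Q N \<le> sqrt (\<delta> + k * m) + sqrt \<epsilon>"
proof (rule fidelity_M_leI[OF assms(1-5)])
  fix P' P'' assume *: "majorized X P (storage N) P'" "majorized (storage N) P' Y P''"
  hence "majorized X P Y P''" by (auto simp: majorized_def intro: order_trans)
  then obtain B where B: "B \<subseteq> Y" "card B \<le> card A" "measure_pmf.prob P A \<le> measure_pmf.prob P'' B"
    using majorizedD[OF _ assms(1,2,6)] by blast
  thus "fidelity Y P'' Q \<le> sqrt (\<delta> + k * m) + sqrt \<epsilon>"
    using assms by (intro fidelity_le_small_support[of Y B]) auto
qed

section \<open>Greedy packing and a lower bound on the deterministic fidelity\<close>

text \<open>Elements are added one by one. If \<open>x\<close> is the element with which the sum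
  first reaches \<open>c\<close>, stopping before \<open>x\<close> misses \<open>c\<close> by at
  most \<open>p x\<close>, hence by at most \<open>m\<close>.\<close>

lemma subset_sum_approx:
  fixes p :: "'a \<Rightarrow> real"
  assumes "finite A" "\<And>x. x \<in> A \<Longrightarrow> p x \<le> m" "0 \<le> m" "0 \<le> c" "c \<le> sum p A"
  shows "\<exists>A'\<subseteq>A. c - m \<le> sum p A' \<and> sum p A' \<le> c"
  using assms(1,2,5)
proof (induction A)
  case empty
  thus ?case using assms by auto
next
  case (insert x A)
  show ?case
  proof (cases "c \<le> sum p A")
    case True
    thus ?thesis using insert by (metis insertCI subset_insertI2)
  next
    case False
    have "p x \<le> m" using insert by simp
    hence "c - m \<le> sum p A \<and> sum p A \<le> c"
      using False insert.prems(2) insert.hyps by simp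
    thus ?thesis by blast
  qed
qed

lemma greedy_packing:
  fixes p :: "'a \<Rightarrow> real" and q :: "'b \<Rightarrow> real"
  assumes "finite B" "finite A" "\<And>x. x \<in> A \<Longrightarrow> 0 \<le> p x \<and> p x \<le> m" "0 \<le> m"
    "\<And>y. y \<in> B \<Longrightarrow> 0 \<le> q y" "sum q B \<le> sum p A"
  shows "\<exists>g. \<forall>y\<in>B. q y - m \<le> sum p {x\<in>A. g x = y}"
  using assms(1,2,3,5,6)
proof (induction B arbitrary: A)
  case (insert y B)
  have "0 \<le> sum q B" using insert by (intro sum_nonneg) auto
  then obtain A' where A': "A' \<subseteq> A" "q y - m \<le> sum p A'" "sum p A' \<le> q y"
    using insert subset_sum_approx[of A p m "q y"] assms(4) by auto
  have "sum p (A - A') = sum p A - sum p A'"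
    using A' insert.prems by (simp add: sum_diff)
  hence "\<exists>g. \<forall>y\<in>B. q y - m \<le> sum p {x\<in>A - A'. g x = y}"
    using insert A' by (intro insert.IH) auto
  then obtain g where g: "\<And>y. y \<in> B \<Longrightarrow> q y - m \<le> sum p {x\<in>A - A'. g x = y}" by blast
  define g' where "g' x = (if x \<in> A' then y else g x)" for x
  have "q z - m \<le> sum p {x\<in>A. g' x = z}" if "z \<in> insert y B" for z
  proof (cases "z = y")
    case True
    \<comment> \<open>\<open>g\<close> may send further elements to \<open>y\<close>; as weights are
      nonnegative, this only fills the bin more.\<close>
    have "sum p A' \<le> sum p {x\<in>A. g' x = z}"
      using A' insert.prems by (intro sum_mono2) (auto simp: g'_def True)
    thus ?thesis using A' True by simp
  next
    case False
    have "sum p {x\<in>A - A'. g x = z} \<le> sum p {x\<in>A. g' x = z}"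
      using insert.prems by (intro sum_mono2) (auto simp: g'_def)
    thus ?thesis using g[of z] False that by simp
  qed
  thus ?case by blast
qed auto

text \<open>
  The elements of \<open>A\<close> are packed into bins \<open>y \<in> B\<close> of capacity \<open>P(A) Q(y)\<close>; each bin is filled up to an
  error \<open>m\<close>, and \<open>\<surd>(ab) \<ge> min a b\<close> turns this into a bound on the fidelity.
\<close>

lemma fidelity_D_ge:
  assumes "finite X" "finite Y" "A \<subseteq> X" "B \<subseteq> Y" "B \<noteq> {}" "real (card B) \<le> 2 powr N"
    and "0 \<le> m" "\<And>x. x \<in> A \<Longrightarrow> pmf P x \<le> m"
  shows "measure_pmf.prob P A * measure_pmf.prob Q B - real (card B) * m \<le> fidelity_D X P Y Q N"
proof -
  define c where "c = measure_pmf.prob P A"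
  have fin: "finite A" "finite B" using assms(1-4) by (auto intro: finite_subset)
  have c: "c = sum (pmf P) A" "0 \<le> c" "c \<le> 1"
    using fin by (auto simp: c_def measure_measure_pmf_finite sum_nonneg sum_pmf_le_1)
  have "(\<Sum>y\<in>B. c * pmf Q y) \<le> c * 1"
    unfolding sum_distrib_left[symmetric] using c sum_pmf_le_1[OF fin(2)]
    by (intro mult_left_mono) auto
  hence "\<exists>g. \<forall>y\<in>B. c * pmf Q y - m \<le> sum (pmf P) {x\<in>A. g x = y}"
    using fin c assms by (intro greedy_packing) auto
  then obtain g where g: "\<And>y. y \<in> B \<Longrightarrow> c * pmf Q y - m \<le> sum (pmf P) {x\<in>A. g x = y}"
    by blast
  obtain y0 where y0: "y0 \<in> B" using assms by auto
  \<comment> \<open>Redirecting to \<open>y0\<close> whatever \<open>g\<close> sends outside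
    \<open>B\<close> limits the number of values to \<open>card B\<close> and takes no mass from any
    bin.\<close>
  define G where "G x = (if g x \<in> B then g x else y0)" for x
  have GB: "G x \<in> B" for x using y0 by (simp add: G_def)
  have low: "c * pmf Q y - m \<le> pmf (map_pmf G P) y" if "y \<in> B" for y
  proof -
    have "c * pmf Q y - m \<le> measure_pmf.prob P {x\<in>A. g x = y}"
      using g[OF that] fin by (simp add: measure_measure_pmf_finite)
    also have "\<dots> \<le> measure_pmf.prob P (G -` {y})"
      using that by (intro measure_pmf.finite_measure_mono) (auto simp: G_def)
    finally show ?thesis by (simp add: pmf_map)
  qed
  have "c * measure_pmf.prob Q B - real (card B) * m = (\<Sum>y\<in>B. c * pmf Q y - m)"
    using fin by (simp add: sum_subtractf sum_distrib_left measure_measure_pmf_finite)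
  also have "\<dots> \<le> (\<Sum>y\<in>B. sqrt (pmf (map_pmf G P) y) * sqrt (pmf Q y))"
  proof (rule sum_mono)
    fix y assume "y \<in> B"
    let ?a = "pmf (map_pmf G P) y" and ?b = "pmf Q y"
    have "c * ?b \<le> ?b" using c by (simp add: mult_left_le_one_le)
    hence "c * ?b - m \<le> min ?a ?b" using low[OF \<open>y \<in> B\<close>] assms(7) by simp
    also have "\<dots> = sqrt (min ?a ?b) * sqrt (min ?a ?b)"
      by simp
    also have "\<dots> \<le> sqrt ?a * sqrt ?b"
      by (intro mult_mono) auto
    finally show "c * ?b - m \<le> sqrt ?a * sqrt ?b" .
  qed
  also have "\<dots> \<le> fidelity Y (map_pmf G P) Q"
    unfolding fidelity_def using assms by (intro sum_mono2) auto
  also have "\<dots> \<le> fidelity_D X P Y Q N"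
  proof -
    obtain h where h: "bij_betw h B {0..<card B}"
      using ex_bij_betw_finite_nat[OF fin(2)] by blast
    define f where "f x = h (G x)" for x
    define f' where "f' k = (if k < card B then inv_into B h k else y0)" for k
    have hl: "h y < card B" if "y \<in> B" for y using bij_betwE[OF h] that by auto
    have st: "k \<in> storage N" if "k < card B" for k
    proof -
      have "int (card B) \<le> \<lfloor>2 powr N\<rfloor>" using assms(6) by (simp add: le_floor_iff)
      thus ?thesis using that by (simp add: storage_def)
    qed
    have f: "f \<in> X \<rightarrow> storage N" using hl[OF GB] st by (auto simp: f_def)
    have "inv_into B h k \<in> B" if "k < card B" for k
      using that h by (metis atLeastLessThan_iff bij_betw_imp_surj_on inv_into_into zero_le)
    hence f': "f' \<in> storage N \<rightarrow> Y" using y0 assms(4) by (auto simp: f'_def)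
    have "f' (f x) = G x" for x
      using hl[OF GB] GB h by (simp add: f_def f'_def bij_betw_inv_into_left)
    hence "map_pmf G P = map_pmf f' (map_pmf f P)" by (simp add: pmf.map_comp comp_def)
    thus ?thesis using fidelity_D_upper[OF assms(2) f f', of P Q] by simp
  qed
  finally show ?thesis by (simp add: c_def)
qed

subsection \<open>Typical words\<close>

text \<open>The variance of the self-information \<open>- log 2 (pmf P x)\<close>, whose mean is the
  entropy; it is the constant in the Chebyshev bounds.\<close>

definition information_variance :: "'a set \<Rightarrow> 'a pmf \<Rightarrow> real" where
  "information_variance X P =
     (\<Sum>x\<in>X. pmf P x * (- log 2 (pmf P x) - shannon_entropy X P)\<^sup>2)"

lemma information_variance_nonneg: "0 \<le> information_variance X P"
  by (simp add: information_variance_def sum_nonneg)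

lemma finite_words: "finite X \<Longrightarrow> finite (words n X)"
  using finite_lists_length_eq[of X n] by (simp add: words_def)

lemma replicate_pmf_distributions:
  "P \<in> distributions X \<Longrightarrow> replicate_pmf n P \<in> distributions (words n X)"
  by (auto simp: distributions_def words_def set_replicate_pmf)

lemma finite_set_replicate_pmf:
  assumes "finite (set_pmf P)"
  shows "finite (set_pmf (replicate_pmf n P))"
  using finite_lists_length_eq[OF assms, of n]
  by (simp add: set_replicate_pmf lists_eq_set)

section \<open>Independent words and sums over their letters\<close>

lemma pmf_replicate_Suc:
  "pmf (replicate_pmf (Suc n) P) (x # xs) = pmf P x * pmf (replicate_pmf n P) xs"
proof -
  have "replicate_pmf (Suc n) P = map_pmf (\<lambda>(x, xs). x # xs) (pair_pmf P (replicate_pmf n P))"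
    by (simp add: pair_pmf_def map_bind_pmf)
  moreover have "inj (\<lambda>(x::'a, xs). x # xs)" by (auto simp: inj_def)
  ultimately show ?thesis
    using pmf_map_inj'[of "\<lambda>(x, xs). x # xs" "pair_pmf P (replicate_pmf n P)" "(x, xs)"]
    by (simp add: pmf_pair)
qed

text \<open>Conditioning on the first letter.\<close>

lemma expectation_replicate_Suc:
  fixes h :: "'a list \<Rightarrow> real"
  assumes "finite X" "set_pmf P \<subseteq> X"
  shows "measure_pmf.expectation (replicate_pmf (Suc n) P) h =
    (\<Sum>x\<in>X. pmf P x * measure_pmf.expectation (replicate_pmf n P) (\<lambda>xs. h (x # xs)))"
proof -
  have fin: "finite (set_pmf (replicate_pmf n P))"
    using assms finite_subset by (intro finite_set_replicate_pmf) blast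
  have "replicate_pmf (Suc n) P = P \<bind> (\<lambda>x. map_pmf ((#) x) (replicate_pmf n P))"
    by (simp add: map_pmf_def)
  thus ?thesis
    using pmf_expectation_bind[of X "\<lambda>x. map_pmf ((#) x) (replicate_pmf n P)" P h] assms fin
    by simp
qed

text \<open>Variances of independent centred terms add up. Both claims share one induction, since
  the cross term of the expanded square vanishes by the first claim.\<close>

lemma expectation_sum_list:
  fixes f :: "'a \<Rightarrow> real"
  assumes "finite X" "set_pmf P \<subseteq> X" "(\<Sum>x\<in>X. pmf P x * f x) = 0"
  shows "measure_pmf.expectation (replicate_pmf n P) (\<lambda>xs. sum_list (map f xs)) = 0"
    and "measure_pmf.expectation (replicate_pmf n P) (\<lambda>xs. (sum_list (map f xs))\<^sup>2)
      = real n * (\<Sum>x\<in>X. pmf P x * (f x)\<^sup>2)"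
proof (induction n)
  case 0
  { case 1 show ?case by simp }
  { case 2 show ?case by simp }
next
  case (Suc n)
  have fin: "finite (set_pmf (replicate_pmf n P))"
    using assms finite_subset by (intro finite_set_replicate_pmf) blast
  note int = integrable_measure_pmf_finite[OF fin]
  have one: "sum (pmf P) X = 1"
    using assms by (intro sum_pmf_eq_1)
  { case 1
    have "measure_pmf.expectation (replicate_pmf n P) (\<lambda>xs. f x + sum_list (map f xs)) = f x" for x
      using Suc(1) by (simp add: int)
    thus ?case
      by (simp add: expectation_replicate_Suc[OF assms(1,2)] assms(3) del: replicate_pmf.simps) }
  { case 2
    have "measure_pmf.expectation (replicate_pmf n P) (\<lambda>xs. (f x + sum_list (map f xs))\<^sup>2)
        = (f x)\<^sup>2 + real n * (\<Sum>x\<in>X. pmf P x * (f x)\<^sup>2)" for x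
      using Suc by (simp add: int power2_sum)
    thus ?case
      by (simp add: expectation_replicate_Suc[OF assms(1,2)] ring_distribs sum.distrib
          sum_distrib_right[symmetric] one del: replicate_pmf.simps) }
qed

text \<open>On the support all factors of the product probability are positive, so its logarithm
  splits into a sum over letters.\<close>

lemma information_sum_list:
  assumes "xs \<in> set_pmf (replicate_pmf n P)"
  shows "sum_list (map (\<lambda>x. - log 2 (pmf P x) - h) xs)
    = - log 2 (pmf (replicate_pmf n P) xs) - real n * h"
  using assms
proof (induction n arbitrary: xs)
  case (Suc n)
  then obtain x ys where xs: "xs = x # ys" "x \<in> set_pmf P" "ys \<in> set_pmf (replicate_pmf n P)"
    by auto
  hence "pmf P x > 0" "pmf (replicate_pmf n P) ys > 0" by (auto simp: pmf_positive)
  hence "log 2 (pmf (replicate_pmf (Suc n) P) xs) = log 2 (pmf P x) + log 2 (pmf (replicate_pmf n P) ys)"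
    unfolding xs(1) pmf_replicate_Suc by (simp add: log_mult)
  thus ?case using Suc.IH[OF xs(3)] by (simp add: xs(1) algebra_simps del: replicate_pmf.simps)
qed simp

text \<open>Chebyshev's inequality for the self-information of a word, that is, Markov's inequality
  for the square of a centred sum.\<close>

lemma information_concentration:
  assumes "finite X" "P \<in> distributions X" "w > 0"
  shows "measure_pmf.prob (replicate_pmf n P)
      {xs. \<bar>- log 2 (pmf (replicate_pmf n P) xs) - real n * shannon_entropy X P\<bar> \<ge> w}
    \<le> real n * information_variance X P / w\<^sup>2"
proof -
  have sub: "set_pmf P \<subseteq> X" using assms by (simp add: distributions_def)
  have fin: "finite (set_pmf (replicate_pmf n P))"
    using assms sub finite_subset by (intro finite_set_replicate_pmf) blast
  let ?R = "replicate_pmf n P"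
  let ?f = "\<lambda>x. - log 2 (pmf P x) - shannon_entropy X P"
  let ?s = "\<lambda>xs. sum_list (map ?f xs)"
  let ?L = "\<lambda>xs. - log 2 (pmf ?R xs) - real n * shannon_entropy X P"
  have "(\<Sum>x\<in>X. pmf P x * ?f x)
      = - (\<Sum>x\<in>X. pmf P x * log 2 (pmf P x)) - sum (pmf P) X * shannon_entropy X P"
    by (simp add: algebra_simps sum_subtractf sum_negf sum_distrib_left sum.distrib)
  also have "\<dots> = 0"
    using sum_pmf_eq_1[OF assms(1) sub] by (simp add: shannon_entropy_def)
  finally have zero: "(\<Sum>x\<in>X. pmf P x * ?f x) = 0" .
  have "measure_pmf.prob ?R {xs. \<bar>?L xs\<bar> \<ge> w} = measure_pmf.prob ?R {xs. (?s xs)\<^sup>2 \<ge> w\<^sup>2}"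
  \<comment> \<open>The two events are compared only on the support, where
    \<open>information_sum_list\<close> identifies \<open>?s\<close> with \<open>?L\<close>; all
    other words have weight 0.\<close>
  proof (rule measure_prob_cong_0)
    have *: "\<bar>?L xs\<bar> \<ge> w \<longleftrightarrow> (?s xs)\<^sup>2 \<ge> w\<^sup>2" if "xs \<in> set_pmf ?R" for xs
      using assms(3) abs_le_square_iff[of w "?L xs"] by (simp add: information_sum_list[OF that])
    show "pmf ?R xs = 0" if "xs \<in> {xs. \<bar>?L xs\<bar> \<ge> w} - {xs. (?s xs)\<^sup>2 \<ge> w\<^sup>2}" for xs
      using that * by (force simp: set_pmf_iff)
    show "pmf ?R xs = 0" if "xs \<in> {xs. (?s xs)\<^sup>2 \<ge> w\<^sup>2} - {xs. \<bar>?L xs\<bar> \<ge> w}" for xs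
      using that * by (force simp: set_pmf_iff)
  qed
  also have "\<dots> \<le> measure_pmf.expectation ?R (\<lambda>xs. (?s xs)\<^sup>2) / w\<^sup>2"
    using integral_Markov_inequality_measure[of "measure_pmf ?R" "\<lambda>xs. (?s xs)\<^sup>2" UNIV "w\<^sup>2"] assms(3)
    by (simp add: integrable_measure_pmf_finite[OF fin])
  also have "measure_pmf.expectation ?R (\<lambda>xs. (?s xs)\<^sup>2) = real n * information_variance X P"
    using expectation_sum_list(2)[OF assms(1) sub zero] by (simp add: information_variance_def)
  finally show ?thesis .
qed

section \<open>Atypical words and codebooks\<close>

lemma prob_large_pmf:
  assumes "finite X" "P \<in> distributions X" "w > 0"
  shows "measure_pmf.prob (replicate_pmf n P)
      {xs. pmf (replicate_pmf n P) xs > 2 powr (- (real n * shannon_entropy X P - w))}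
    \<le> real n * information_variance X P / w\<^sup>2"
proof (rule order_trans[OF measure_pmf.finite_measure_mono information_concentration[OF assms]])
  let ?R = "replicate_pmf n P"
  let ?h = "real n * shannon_entropy X P"
  show "{xs. pmf ?R xs > 2 powr (- (?h - w))} \<subseteq> {xs. \<bar>- log 2 (pmf ?R xs) - ?h\<bar> \<ge> w}"
  proof clarify
    fix xs assume *: "pmf ?R xs > 2 powr (- (?h - w))"
    hence "pmf ?R xs > 0" using powr_gt_zero[of 2] by (metis less_trans zero_neq_numeral)
    hence "log 2 (pmf ?R xs) > - (?h - w)" using * by (subst less_log_iff) auto
    thus "\<bar>- log 2 (pmf ?R xs) - ?h\<bar> \<ge> w" by linarith
  qed
qed auto

lemma prob_small_pmf:
  assumes "finite X" "P \<in> distributions X" "w > 0"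
  shows "measure_pmf.prob (replicate_pmf n P)
      {xs. pmf (replicate_pmf n P) xs < 2 powr (- (real n * shannon_entropy X P + w))}
    \<le> real n * information_variance X P / w\<^sup>2"
proof -
  let ?R = "replicate_pmf n P"
  let ?h = "real n * shannon_entropy X P"
  \<comment> \<open>Words of probability 0 satisfy the strict bound although their logarithm carries
    no information; intersecting with the support removes them.\<close>
  have "measure_pmf.prob ?R {xs. pmf ?R xs < 2 powr (- (?h + w))}
      = measure_pmf.prob ?R ({xs. pmf ?R xs < 2 powr (- (?h + w))} \<inter> set_pmf ?R)"
    by (simp add: measure_Int_set_pmf)
  also have "\<dots> \<le> measure_pmf.prob ?R {xs. \<bar>- log 2 (pmf ?R xs) - ?h\<bar> \<ge> w}"
  proof (rule measure_pmf.finite_measure_mono)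
    show "{xs. pmf ?R xs < 2 powr (- (?h + w))} \<inter> set_pmf ?R \<subseteq> {xs. \<bar>- log 2 (pmf ?R xs) - ?h\<bar> \<ge> w}"
    proof clarify
      fix xs assume *: "pmf ?R xs < 2 powr (- (?h + w))" "xs \<in> set_pmf ?R"
      hence "pmf ?R xs > 0" by (simp add: pmf_positive)
      hence "log 2 (pmf ?R xs) < - (?h + w)" using * by (subst log_less_iff) auto
      thus "\<bar>- log 2 (pmf ?R xs) - ?h\<bar> \<ge> w" by linarith
    qed
  qed auto
  also note information_concentration[OF assms]
  finally show ?thesis .
qed

lemma prob_Collect_not:
  "measure_pmf.prob P {x. \<not> A x} = 1 - measure_pmf.prob P {x. A x}"
  using measure_pmf.prob_compl[of "{x. A x}" P] by (simp add: set_diff_eq)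

lemma prob_carrier_Int:
  assumes "P \<in> distributions X"
  shows "measure_pmf.prob P (X \<inter> A) = measure_pmf.prob P A"
proof -
  have "measure_pmf.prob P (X \<inter> A) = measure_pmf.prob P ((X \<inter> A) \<inter> set_pmf P)"
    by (simp add: measure_Int_set_pmf)
  also have "(X \<inter> A) \<inter> set_pmf P = A \<inter> set_pmf P"
    using assms by (auto simp: distributions_def)
  finally show ?thesis by (simp add: measure_Int_set_pmf)
qed

text \<open>The words of weight at least \<open>?c\<close> number at most \<open>1 / ?c\<close>,
  because their weights sum to at most 1. The set serves as target codebook for achievability and as
  likely source set for the converse.\<close>

lemma high_probability_codebook:
  assumes "finite X" "P \<in> distributions X" "w > 0"
  shows "\<exists>A \<subseteq> words n X. real (card A) \<le> 2 powr (real n * shannon_entropy X P + w) \<and>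
    measure_pmf.prob (replicate_pmf n P) A \<ge> 1 - real n * information_variance X P / w\<^sup>2"
proof -
  let ?R = "replicate_pmf n P"
  let ?c = "2 powr (- (real n * shannon_entropy X P + w))"
  let ?A = "words n X \<inter> {xs. \<not> pmf ?R xs < ?c}"
  have fin: "finite ?A" using finite_words[OF assms(1)] by blast
  have "real (card ?A) * ?c \<le> sum (pmf ?R) ?A"
    by (intro sum_bounded_below) auto
  also have "\<dots> \<le> 1" by (rule sum_pmf_le_1[OF fin])
  finally have "real (card ?A) \<le> 1 / ?c"
    by (subst pos_le_divide_eq) auto
  also have "1 / ?c = 2 powr (real n * shannon_entropy X P + w)"
    by (simp only: powr_minus_divide) simp
  finally have "real (card ?A) \<le> 2 powr (real n * shannon_entropy X P + w)" .
  moreover have "measure_pmf.prob ?R ?A \<ge> 1 - real n * information_variance X P / w\<^sup>2"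
    unfolding prob_carrier_Int[OF replicate_pmf_distributions[OF assms(2)]] prob_Collect_not
    using prob_small_pmf[OF assms] by simp
  ultimately show ?thesis
    by (intro exI[of _ ?A] conjI Int_lower1)
qed

subsection \<open>The rate region\<close>

lemma achievable_D:
  assumes "finite X" "finite Y" "P \<in> distributions X" "Q \<in> distributions Y"
    and "shannon_entropy Y Q > 0" "\<nu> < 1" "0 < s" "0 < t"
    and "t * shannon_entropy Y Q \<le> s" "t * shannon_entropy Y Q \<le> shannon_entropy X P"
  shows "(s, t) \<in> rate_region_D X P Y Q \<nu>"
proof -
  define HP where "HP = shannon_entropy X P"
  define HQ where "HQ = shannon_entropy Y Q"
  define VP where "VP = information_variance X P"
  define VQ where "VQ = information_variance Y Q"
  have HQ: "HQ > 0" using assms by (simp add: HQ_def)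
  \<comment> \<open>Any exponent strictly between 1/2 (Chebyshev) and 1 (so that the rates are unaffected) works.\<close>
  define w where "w n = real n powr (2/3)" for n
  define S where "S n = s * real n" for n
  \<comment> \<open>This lowers the target exponent by \<open>3 * w n\<close>: one
    \<open>w n\<close> pays for the codebook size, one for the fluctuation of the source weights,
    and one makes \<open>real (card B) * m\<close> vanish.\<close>
  define T where "T n = nat \<lfloor>t * real n - 3 * w n / HQ\<rfloor>" for n
  define F where "F n = fidelity_D (words n X) (replicate_pmf n P)
    (words (T n) Y) (replicate_pmf (T n) Q) (S n)" for n
  \<comment> \<open>The bound of \<open>fidelity_D_ge\<close> with explicit Chebyshev errors, where
    \<open>T n\<close> is replaced by its upper bound \<open>t * real n\<close>. It tends to 1, so
    every \<open>\<nu>\<close> below 1 is reached.\<close>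
  define b where "b n = (1 - VP * (real n / (w n)\<^sup>2)) * (1 - t * VQ * (real n / (w n)\<^sup>2)) - 2 powr (- w n)" for n
  have lim: "(\<lambda>n. real n / (w n)\<^sup>2) \<longlonglongrightarrow> 0" "(\<lambda>n. 2 powr (- w n)) \<longlonglongrightarrow> 0"
    unfolding w_def by real_asymp+
  have l1: "(\<lambda>n. 1 - VP * (real n / (w n)\<^sup>2)) \<longlonglongrightarrow> 1 - VP * 0"
    by (intro tendsto_intros lim)
  have l2: "(\<lambda>n. 1 - t * VQ * (real n / (w n)\<^sup>2)) \<longlonglongrightarrow> 1 - t * VQ * 0"
    by (intro tendsto_intros lim)
  have bl: "b \<longlonglongrightarrow> 1"
    using tendsto_diff[OF tendsto_mult[OF l1 l2] lim(2)] by (simp add: b_def[abs_def])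
  have wl: "(\<lambda>n. w n / real n) \<longlonglongrightarrow> 0" unfolding w_def by real_asymp
  have e1: "eventually (\<lambda>n. 0 < 1 - VP * (real n / (w n)\<^sup>2)) sequentially"
    using order_tendstoD(1)[OF l1, of 0] by simp
  have e2: "eventually (\<lambda>n. 0 < 1 - t * VQ * (real n / (w n)\<^sup>2)) sequentially"
    using order_tendstoD(1)[OF l2, of 0] by simp
  \<comment> \<open>Eventually the argument of the floor in \<open>T\<close> is positive, so
    \<open>nat\<close> does not truncate.\<close>
  have e3: "eventually (\<lambda>n. w n / real n < t * HQ / 3) sequentially"
    using order_tendstoD(2)[OF wl, of "t * HQ / 3"] HQ assms by simp
  have "eventually (\<lambda>n. b n \<le> F n) sequentially"
    using e1 e2 e3 eventually_gt_at_top[of 0]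
  proof eventually_elim
    case (elim n)
    have w: "w n > 0" using elim by (simp add: w_def)
    have n: "real n > 0" using elim by simp
    have "0 < t * real n - 3 * w n / HQ"
      using elim(3) n HQ by (simp add: field_simps)
    hence T: "real (T n) \<le> t * real n - 3 * w n / HQ"
      by (simp add: T_def)
    hence THQ: "real (T n) * HQ \<le> t * HQ * real n - 3 * w n"
      using HQ by (simp add: field_simps)
    have "0 \<le> 3 * w n / HQ" using w HQ by simp
    hence Tn: "real (T n) \<le> t * real n" using T by linarith
    define m where "m = 2 powr (- (real n * HP - w n))"
    define A where "A = words n X \<inter> {xs. \<not> pmf (replicate_pmf n P) xs > m}"
    have A: "A \<subseteq> words n X" "\<And>xs. xs \<in> A \<Longrightarrow> pmf (replicate_pmf n P) xs \<le> m"
      by (auto simp: A_def)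
    have pA: "measure_pmf.prob (replicate_pmf n P) A \<ge> 1 - VP * (real n / (w n)\<^sup>2)"
      unfolding A_def prob_carrier_Int[OF replicate_pmf_distributions[OF assms(3)]] prob_Collect_not
      using prob_large_pmf[OF assms(1,3) w, of n] by (simp add: m_def HP_def VP_def mult.commute)
    obtain B where B: "B \<subseteq> words (T n) Y" "real (card B) \<le> 2 powr (real (T n) * HQ + w n)"
      "measure_pmf.prob (replicate_pmf (T n) Q) B \<ge> 1 - real (T n) * VQ / (w n)\<^sup>2"
      using high_probability_codebook[OF assms(2,4) w, of "T n"] by (auto simp: HQ_def VQ_def)
    have "real (T n) * VQ / (w n)\<^sup>2 \<le> t * real n * VQ / (w n)\<^sup>2"
      using Tn information_variance_nonneg[of Y Q]
      by (intro divide_right_mono mult_right_mono) (auto simp: VQ_def)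
    hence pB: "measure_pmf.prob (replicate_pmf (T n) Q) B \<ge> 1 - t * VQ * (real n / (w n)\<^sup>2)"
      using B(3) by (simp add: mult_ac)
    hence "B \<noteq> {}" using elim by auto
    have "real (card B) \<le> 2 powr (S n)"
    proof (rule order_trans[OF B(2)])
      have "t * HQ * real n \<le> s * real n"
        using assms n by (intro mult_right_mono) (auto simp: HQ_def)
      thus "2 powr (real (T n) * HQ + w n) \<le> 2 powr (S n)"
        using THQ w by (simp add: S_def)
    qed
    have cm: "real (card B) * m \<le> 2 powr (- w n)"
    proof -
      have "real (card B) * m \<le> 2 powr (real (T n) * HQ + w n) * m"
        using B by (intro mult_right_mono) (auto simp: m_def)
      also have "\<dots> = 2 powr (real (T n) * HQ + w n - (real n * HP - w n))"
        by (simp add: m_def powr_add[symmetric])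
      also have "\<dots> \<le> 2 powr (- w n)"
      proof -
        have "t * HQ * real n \<le> HP * real n"
          using assms n by (intro mult_right_mono) (auto simp: HQ_def HP_def)
        thus ?thesis using THQ by (simp add: mult.commute)
      qed
      finally show ?thesis .
    qed
    have "b n \<le> measure_pmf.prob (replicate_pmf n P) A * measure_pmf.prob (replicate_pmf (T n) Q) B
        - real (card B) * m"
      unfolding b_def using pA pB cm elim
      by (intro diff_mono mult_mono) auto
    also have "\<dots> \<le> F n"
      unfolding F_def
      by (intro fidelity_D_ge finite_words assms(1,2) A B(1) \<open>B \<noteq> {}\<close> \<open>real (card B) \<le> 2 powr (S n)\<close>)
         (simp_all add: m_def)
    finally show ?case .
  qed
  hence "liminf (\<lambda>n. ereal (b n)) \<le> liminf (\<lambda>n. ereal (F n))"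
    by (intro Liminf_mono) auto
  moreover have "liminf (\<lambda>n. ereal (b n)) = ereal 1"
    using bl by (intro lim_imp_Liminf) auto
  ultimately have "ereal 1 \<le> liminf (\<lambda>n. ereal (F n))"
    by simp
  moreover have "ereal \<nu> \<le> ereal 1" using assms by simp
  ultimately have "ereal \<nu> \<le> liminf (\<lambda>n. ereal (F n))"
    by (rule order_trans[rotated])
  moreover have "(\<lambda>n. real (T n) - t * real n) \<in> o(\<lambda>n. real n)"
  proof (rule landau_o.big_small_trans[OF landau_o.big_mono])
    have "norm (real (T n) - t * real n) \<le> norm (3 / HQ * w n + 1)" for n
    proof -
      have "0 \<le> 3 / HQ * w n" using HQ by (simp add: w_def)
      moreover have "0 \<le> t * real n" using assms by simp
      \<comment> \<open>The estimate holds for every \<open>n\<close>: where \<open>nat\<close>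
        truncates to 0, \<open>t * real n\<close> itself lies below the error term.\<close>
      moreover have "real (T n) = max 0 (of_int \<lfloor>t * real n - 3 / HQ * w n\<rfloor>)"
        by (simp add: T_def of_nat_nat max_def)
      ultimately show ?thesis
        by simp linarith
    qed
    thus "eventually (\<lambda>n. norm (real (T n) - t * real n) \<le> norm (3 / HQ * w n + 1)) sequentially"
      by simp
    have "(\<lambda>n. w n) \<in> o(\<lambda>n. real n)" "(\<lambda>n. 1) \<in> o(\<lambda>n. real n)"
      unfolding w_def by real_asymp+
    thus "(\<lambda>n. 3 / HQ * w n + 1) \<in> o(\<lambda>n. real n)"
      using HQ by (intro sum_in_smallo) auto
  qed
  moreover have "(\<lambda>n. S n - s * real n) \<in> o(\<lambda>n. real n)" "\<And>n. S n \<ge> 0"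
    using assms by (auto simp: S_def)
  ultimately show ?thesis
    using assms unfolding rate_region_def F_def by blast
qed

section \<open>Inclusion of the regions and the converse\<close>

lemma liminf_le_0:
  assumes "eventually (\<lambda>n. f n \<le> g n) sequentially" "g \<longlonglongrightarrow> (0::real)"
  shows "liminf (\<lambda>n. ereal (f n)) \<le> ereal 0"
proof -
  have "liminf (\<lambda>n. ereal (f n)) \<le> liminf (\<lambda>n. ereal (g n))"
    using assms(1) by (intro Liminf_mono) auto
  also have "liminf (\<lambda>n. ereal (g n)) = ereal 0"
    using assms(2) by (intro lim_imp_Liminf) auto
  finally show ?thesis .
qed

text \<open>The same sequences \<open>S\<close> and \<open>T\<close> serve as witnesses.\<close>

lemma rate_region_D_subset_M:
  assumes "finite X" "finite Y" "P \<in> distributions X" "Q \<in> distributions Y"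
  shows "rate_region_D X P Y Q \<nu> \<subseteq> rate_region_M X P Y Q \<nu>"
proof clarify
  fix s t assume "(s, t) \<in> rate_region_D X P Y Q \<nu>"
  then obtain S T where st: "s > 0" "t > 0" "\<forall>n. S n \<ge> 0"
      "(\<lambda>n. S n - s * real n) \<in> o(\<lambda>n. real n)"
      "(\<lambda>n. real (T n) - t * real n) \<in> o(\<lambda>n. real n)"
    and lim: "ereal \<nu> \<le> liminf (\<lambda>n. ereal (fidelity_D (words n X) (replicate_pmf n P)
       (words (T n) Y) (replicate_pmf (T n) Q) (S n)))"
    by (auto simp: rate_region_def)
  have "fidelity_D (words n X) (replicate_pmf n P) (words (T n) Y) (replicate_pmf (T n) Q) (S n)
    \<le> fidelity_M (words n X) (replicate_pmf n P) (words (T n) Y) (replicate_pmf (T n) Q) (S n)" for n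
    using assms st(3) by (intro fidelity_D_le_M finite_words replicate_pmf_distributions) auto
  hence "liminf (\<lambda>n. ereal (fidelity_D (words n X) (replicate_pmf n P)
       (words (T n) Y) (replicate_pmf (T n) Q) (S n)))
    \<le> liminf (\<lambda>n. ereal (fidelity_M (words n X) (replicate_pmf n P)
       (words (T n) Y) (replicate_pmf (T n) Q) (S n)))"
    by (intro Liminf_mono) auto
  with lim have "ereal \<nu> \<le> liminf (\<lambda>n. ereal (fidelity_M (words n X) (replicate_pmf n P)
       (words (T n) Y) (replicate_pmf (T n) Q) (S n)))"
    by (rule order_trans)
  with st show "(s, t) \<in> rate_region_M X P Y Q \<nu>"
    unfolding rate_region_def by blast
qed

lemma smallo_diff_eventually:
  assumes "(\<lambda>n. f n - c * real n) \<in> o(\<lambda>n. real n)" "\<delta> > 0"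
  shows "eventually (\<lambda>n. \<bar>f n - c * real n\<bar> \<le> \<delta> * real n) sequentially"
  using landau_o.smallD[OF assms] by simp

lemma converse_M:
  assumes "finite X" "finite Y" "P \<in> distributions X" "Q \<in> distributions Y"
    and "shannon_entropy Y Q > 0" "0 < \<nu>" "(s, t) \<in> rate_region_M X P Y Q \<nu>"
  shows "t * shannon_entropy Y Q \<le> s \<and> t * shannon_entropy Y Q \<le> shannon_entropy X P"
proof -
  define HP where "HP = shannon_entropy X P"
  define HQ where "HQ = shannon_entropy Y Q"
  define VP where "VP = information_variance X P"
  define VQ where "VQ = information_variance Y Q"
  have HQ: "HQ > 0" using assms by (simp add: HQ_def)
  obtain S T where st: "s > 0" "t > 0" and S0: "\<And>n. S n \<ge> 0"
    and S: "(\<lambda>n. S n - s * real n) \<in> o(\<lambda>n. real n)"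
    and T: "(\<lambda>n. real (T n) - t * real n) \<in> o(\<lambda>n. real n)"
    and lim: "ereal \<nu> \<le> liminf (\<lambda>n. ereal (fidelity_M (words n X) (replicate_pmf n P)
       (words (T n) Y) (replicate_pmf (T n) Q) (S n)))"
    using assms(7) by (auto simp: rate_region_def)
  define F where "F n = fidelity_M (words n X) (replicate_pmf n P)
    (words (T n) Y) (replicate_pmf (T n) Q) (S n)" for n
  \<comment> \<open>Target words above this weight are atypical. The deviation
    \<open>\<delta> * real n\<close> may be linear here, because the assumed rate gap is linear
    too.\<close>
  define m where "m \<delta> n = 2 powr (- (real (T n) * HQ - \<delta> * real n))" for \<delta> n
  \<comment> \<open>The first summand bounds the probability of the target words above
    \<open>m \<delta> n\<close>, the second the contribution of the remaining words in a small
    set.\<close>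
  define B where "B \<delta> n = (t + 1) * VQ / \<delta>\<^sup>2 * (1 / real n) + 2 powr (- \<delta> * real n)" for \<delta> n
  have target: "measure_pmf.prob (replicate_pmf (T n) Q) {ys. pmf (replicate_pmf (T n) Q) ys > m \<delta> n}
      \<le> (t + 1) * VQ / \<delta>\<^sup>2 * (1 / real n)"
    if "\<delta> > 0" "n > 0" "real (T n) \<le> (t + 1) * real n" for \<delta> n
  proof -
    have "measure_pmf.prob (replicate_pmf (T n) Q) {ys. pmf (replicate_pmf (T n) Q) ys > m \<delta> n}
        \<le> real (T n) * VQ / (\<delta> * real n)\<^sup>2"
      using prob_large_pmf[OF assms(2,4), of "\<delta> * real n" "T n"] that
      by (simp add: m_def HQ_def VQ_def)
    also have "\<dots> \<le> (t + 1) * real n * VQ / (\<delta> * real n)\<^sup>2"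
      using that information_variance_nonneg[of Y Q]
      by (intro divide_right_mono mult_right_mono) (auto simp: VQ_def)
    also have "\<dots> = (t + 1) * VQ / \<delta>\<^sup>2 * (1 / real n)"
      using that by (simp add: power2_eq_square)
    finally show ?thesis .
  qed
  \<comment> \<open>Here \<open>k\<close> is the exponent of the number of available words and
    \<open>h\<close> its rate. Of the gap \<open>4 * \<delta>\<close>, one \<open>\<delta>\<close>
    covers \<open>k\<close>, one the deviation of \<open>T n\<close>, one the slack in
    \<open>m\<close>, and the last remains as exponential decay.\<close>
  have product: "2 powr k * m \<delta> n \<le> 2 powr (- \<delta> * real n)"
    if "\<delta> > 0" "k \<le> (h + \<delta>) * real n" "\<bar>real (T n) - t * real n\<bar> \<le> \<delta> / HQ * real n"
      "t * HQ - h = 4 * \<delta>" for \<delta> h n k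
  proof -
    have "t * real n - real (T n) \<le> \<delta> / HQ * real n" using that(3) by linarith
    hence "(t * real n - real (T n)) * HQ \<le> \<delta> / HQ * real n * HQ"
      using HQ by (intro mult_right_mono) auto
    hence "t * HQ * real n - real (T n) * HQ \<le> \<delta> * real n"
      using HQ by (simp add: algebra_simps)
    moreover have "t * HQ * real n = (h + 4 * \<delta>) * real n"
      using that(4) by (simp add: algebra_simps)
    ultimately have "k - (real (T n) * HQ - \<delta> * real n) \<le> - \<delta> * real n"
      using that(2) by (simp add: algebra_simps)
    thus ?thesis by (simp add: m_def powr_add[symmetric])
  qed
  have Blim: "(\<lambda>n. sqrt (B \<delta> n)) \<longlonglongrightarrow> 0" if "\<delta> > 0" for \<delta>
  proof -
    have "(\<lambda>n. 2 powr (- \<delta> * real n)) \<longlonglongrightarrow> 0" using that by real_asymp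
    moreover have "(\<lambda>n. 1 / real n) \<longlonglongrightarrow> 0" by real_asymp
    ultimately have "(\<lambda>n. sqrt (B \<delta> n)) \<longlonglongrightarrow> sqrt ((t + 1) * VQ / \<delta>\<^sup>2 * 0 + 0)"
      unfolding B_def by (intro tendsto_intros)
    thus ?thesis by simp
  qed
  have Tev: "eventually (\<lambda>n. \<bar>real (T n) - t * real n\<bar> \<le> c * real n) sequentially" if "c > 0" for c
    by (rule smallo_diff_eventually[OF T that])
  have T1: "eventually (\<lambda>n. real (T n) \<le> (t + 1) * real n) sequentially"
    using Tev[of 1] by (rule eventually_mono) (auto simp: algebra_simps)
  have "t * HQ \<le> s"
  proof (rule ccontr)
    assume "\<not> t * HQ \<le> s"
    define \<delta> where "\<delta> = (t * HQ - s) / 4"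
    have \<delta>: "\<delta> > 0" "t * HQ - s = 4 * \<delta>" using \<open>\<not> t * HQ \<le> s\<close> by (auto simp: \<delta>_def)
    have "\<delta> / HQ > 0" using \<delta> HQ by simp
    have "eventually (\<lambda>n. F n \<le> sqrt (B \<delta> n)) sequentially"
      using T1 Tev[OF \<open>\<delta> / HQ > 0\<close>] smallo_diff_eventually[OF S \<delta>(1)] eventually_gt_at_top[of 0]
    proof eventually_elim
      case (elim n)
      have "F n \<le> sqrt ((t + 1) * VQ / \<delta>\<^sup>2 * (1 / real n) + 2 powr (S n) * m \<delta> n)"
        unfolding F_def using assms S0 target[OF \<delta>(1) elim(4) elim(1)]
        by (intro fidelity_M_le_storage finite_words replicate_pmf_distributions) (auto simp: m_def)
      also have "\<dots> \<le> sqrt (B \<delta> n)"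
      proof -
        have "S n \<le> (s + \<delta>) * real n" using elim(3) by (simp add: algebra_simps)
        from product[OF \<delta>(1) this elim(2) \<delta>(2)] show ?thesis by (simp add: B_def)
      qed
      finally show ?case .
    qed
    from liminf_le_0[OF this Blim[OF \<delta>(1)]] lim have "ereal \<nu> \<le> ereal 0"
      unfolding F_def by (rule order_trans[rotated])
    thus False using assms by simp
  qed
  moreover have "t * HQ \<le> HP"
  proof (rule ccontr)
    assume "\<not> t * HQ \<le> HP"
    define \<delta> where "\<delta> = (t * HQ - HP) / 4"
    have \<delta>: "\<delta> > 0" "t * HQ - HP = 4 * \<delta>" using \<open>\<not> t * HQ \<le> HP\<close> by (auto simp: \<delta>_def)
    have "\<delta> / HQ > 0" using \<delta> HQ by simp
    \<comment> \<open>The additional root accounts for the source mass outside its codebook.\<close>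
    have "eventually (\<lambda>n. F n \<le> sqrt (B \<delta> n) + sqrt (VP / \<delta>\<^sup>2 * (1 / real n))) sequentially"
      using T1 Tev[OF \<open>\<delta> / HQ > 0\<close>] eventually_gt_at_top[of 0]
    proof eventually_elim
      case (elim n)
      have w: "\<delta> * real n > 0" using \<delta> elim by simp
      obtain A where A: "A \<subseteq> words n X" "real (card A) \<le> 2 powr (real n * HP + \<delta> * real n)"
        "measure_pmf.prob (replicate_pmf n P) A \<ge> 1 - real n * VP / (\<delta> * real n)\<^sup>2"
        using high_probability_codebook[OF assms(1,3) w, of n] by (auto simp: HP_def VP_def)
      have "real n * VP / (\<delta> * real n)\<^sup>2 = VP / \<delta>\<^sup>2 * (1 / real n)"
        using elim by (simp add: power2_eq_square)
      with A have "F n \<le> sqrt ((t + 1) * VQ / \<delta>\<^sup>2 * (1 / real n)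
          + 2 powr (real n * HP + \<delta> * real n) * m \<delta> n) + sqrt (VP / \<delta>\<^sup>2 * (1 / real n))"
        unfolding F_def using assms S0 target[OF \<delta>(1) elim(3) elim(1)]
        by (intro fidelity_M_le_source finite_words replicate_pmf_distributions) (auto simp: m_def)
      also have "\<dots> \<le> sqrt (B \<delta> n) + sqrt (VP / \<delta>\<^sup>2 * (1 / real n))"
      proof -
        have "real n * HP + \<delta> * real n \<le> (HP + \<delta>) * real n" by (simp add: algebra_simps)
        from product[OF \<delta>(1) this elim(2) \<delta>(2)] show ?thesis by (simp add: B_def)
      qed
      finally show ?case .
    qed
    moreover have "(\<lambda>n. sqrt (B \<delta> n) + sqrt (VP / \<delta>\<^sup>2 * (1 / real n))) \<longlonglongrightarrow> 0"
    proof -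
      have "(\<lambda>n. 1 / real n) \<longlonglongrightarrow> 0" by real_asymp
      hence "(\<lambda>n. sqrt (B \<delta> n) + sqrt (VP / \<delta>\<^sup>2 * (1 / real n))) \<longlonglongrightarrow> 0 + sqrt (VP / \<delta>\<^sup>2 * 0)"
        by (intro tendsto_intros Blim \<delta>)
      thus ?thesis by simp
    qed
    ultimately have "ereal \<nu> \<le> ereal 0"
      using liminf_le_0 lim unfolding F_def by (meson order_trans)
    thus False using assms by simp
  qed
  ultimately show ?thesis by (simp add: HP_def HQ_def)
qed

text \<open>The inclusions close a cycle: \<open>R\<close> lies in the deterministic region, which
  lies in the majorization region, which lies in \<open>R\<close>.\<close>

lemma rate_region_eq:
  assumes "finite X" "finite Y" "P \<in> distributions X" "Q \<in> distributions Y"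
    and "shannon_entropy Y Q > 0" "0 < \<nu>" "\<nu> < 1"
  defines "R \<equiv> {(s, t). 0 < s \<and> 0 < t \<and> t * shannon_entropy Y Q \<le> s \<and>
    t * shannon_entropy Y Q \<le> shannon_entropy X P}"
  shows "rate_region_D X P Y Q \<nu> = R" "rate_region_M X P Y Q \<nu> = R"
proof -
  have "R \<subseteq> rate_region_D X P Y Q \<nu>"
    using achievable_D[OF assms(1-5,7)] by (auto simp: R_def)
  moreover have "rate_region_M X P Y Q \<nu> \<subseteq> R"
  proof clarify
    fix s t assume *: "(s, t) \<in> rate_region_M X P Y Q \<nu>"
    hence "0 < s" "0 < t" by (auto simp: rate_region_def)
    with converse_M[OF assms(1-6) *] show "(s, t) \<in> R" by (simp add: R_def)
  qed
  moreover note rate_region_D_subset_M[OF assms(1-4), of \<nu>]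
  ultimately show "rate_region_D X P Y Q \<nu> = R" "rate_region_M X P Y Q \<nu> = R"
    by blast+
qed

section \<open>Extremal pairs of the truncated cone\<close>

lemma semi_admissible_truncated_cone:
  fixes a b :: real
  assumes "a > 0" "b > 0"
  shows "{p. semi_admissible {(s, t). 0 < s \<and> 0 < t \<and> t * b \<le> s \<and> t * b \<le> a} p}
    = {(s, s / b) | s. 0 < s \<and> s \<le> a}" (is "{p. semi_admissible ?R p} = ?S")
proof (intro set_eqI iffI)
  fix p assume "p \<in> {p. semi_admissible ?R p}"
  hence p: "p \<in> ?R" and n: "\<And>q. q \<in> ?R \<Longrightarrow> dominates q p \<Longrightarrow> q = p"
    by (auto simp: semi_admissible_def)
  obtain s t where st: "p = (s, t)" by force
  \<comment> \<open>Lowering the first rate to \<open>t * b\<close> stays in the region and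
    dominates \<open>p\<close>.\<close>
  have "(t * b, t) = p"
    using p assms by (intro n) (auto simp: st dominates_def)
  hence "s = t * b" by (simp add: st)
  thus "p \<in> ?S" using p assms by (auto simp: st)
next
  fix p assume "p \<in> ?S"
  then obtain s where s: "p = (s, s / b)" "0 < s" "s \<le> a" by auto
  have "q = p" if "q \<in> ?R" "dominates q p" for q
  proof -
    obtain u v where q: "q = (u, v)" by force
    have *: "v * b \<le> u" "u \<le> s" "s / b \<le> v" using that s by (auto simp: q dominates_def)
    \<comment> \<open>This closes the chain \<open>s \<le> v * b \<le> u \<le> s\<close>, which
      forces equality throughout.\<close>
    have "s \<le> v * b" using *(3) assms by (simp add: field_simps)
    hence "u = s" "v * b = s" using * by linarith+
    thus ?thesis using assms s by (auto simp: q)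
  qed
  thus "p \<in> {p. semi_admissible ?R p}"
    using s assms by (auto simp: semi_admissible_def)
qed

text \<open>All semi-admissible pairs lie on the segment from the origin to the corner
  \<open>(a, a / b)\<close>, so the corner simulates them. A pair simulating the corner lies on the
  same ray at least as far out, where \<open>t * b \<le> a\<close> leaves only the corner.\<close>

lemma admissible_truncated_cone:
  fixes a b :: real
  assumes "a > 0" "b > 0"
  shows "{p. admissible {(s, t). 0 < s \<and> 0 < t \<and> t * b \<le> s \<and> t * b \<le> a} p} = {(a, a / b)}"
    (is "{p. admissible ?R p} = _")
proof (intro set_eqI iffI)
  fix p assume "p \<in> {p. admissible ?R p}"
  hence ad: "admissible ?R p" by simp
  hence "semi_admissible ?R p" by (auto simp: admissible_def semi_admissible_def)
  hence "p \<in> {(s, s / b) | s. 0 < s \<and> s \<le> a}"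
    using semi_admissible_truncated_cone[OF assms] by blast
  then obtain s where s: "p = (s, s / b)" "0 < s" "s \<le> a" by auto
  have "simulates (a, a / b) p"
    using s assms by (auto simp: simulates_def)
  moreover have "(a, a / b) \<in> ?R" using assms by simp
  ultimately have "(a, a / b) = p" using ad unfolding admissible_def by blast
  thus "p \<in> {(a, a / b)}" by simp
next
  fix p assume "p \<in> {(a, a / b)}"
  hence p: "p = (a, a / b)" by simp
  hence "semi_admissible ?R p"
    using semi_admissible_truncated_cone[OF assms] assms by blast
  moreover have "q = p" if "q \<in> ?R" "simulates q p" for q
  proof -
    obtain u v where q: "q = (u, v)" by force
    have *: "0 < u" "0 < v" "v * b \<le> a" "a / u = a / b / v" "a / u \<le> 1"
      using that by (auto simp: q p simulates_def)
    have "u = v * b" using *(1,2,4) assms by (simp add: field_simps)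
    moreover have "a \<le> u" using *(1,5) by (simp add: field_simps)
    ultimately show ?thesis using *(3) assms by (auto simp: q p)
  qed
  ultimately show "p \<in> {p. admissible ?R p}"
    by (auto simp: admissible_def semi_admissible_def)
qed

theorem corollary18:
  fixes X :: "'a set" and P :: "'a pmf" and Y :: "'b set" and Q :: "'b pmf" and \<nu> :: real
  assumes "finite X" and "finite Y"
    and "P \<in> distributions X" and "Q \<in> distributions Y"
    and "shannon_entropy X P > 0" and "shannon_entropy Y Q > 0"
    and "0 < \<nu>" and "\<nu> < 1"
  shows "rate_region_D X P Y Q \<nu> = rate_region_M X P Y Q \<nu> \<and>
    (\<forall>\<mu>. 0 < \<mu> \<and> \<mu> < 1 \<longrightarrow>
       rate_region_D X P Y Q \<mu> = rate_region_D X P Y Q \<nu> \<and>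
       rate_region_M X P Y Q \<mu> = rate_region_M X P Y Q \<nu>) \<and>
    (\<forall>R \<in> {rate_region_D X P Y Q \<nu>, rate_region_M X P Y Q \<nu>}.
       {p. semi_admissible R p} =
         {(s, s / shannon_entropy Y Q) | s. 0 < s \<and> s \<le> shannon_entropy X P} \<and>
       {p. admissible R p} =
         {(shannon_entropy X P, shannon_entropy X P / shannon_entropy Y Q)})"
  \<comment> \<open>The parameter of \<open>rate_region_eq\<close> stays schematic, so the regions
    for \<open>\<mu>\<close> and for \<open>\<nu>\<close> rewrite to the same cone.\<close>
  using rate_region_eq[OF assms(1-4,6)] assms(7,8)
    semi_admissible_truncated_cone[OF assms(5,6)] admissible_truncated_cone[OF assms(5,6)]
  by simp

end
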